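(* Let $\kappa=[2\ell-1]$ for some $\ell\in\mathbb Z$, let $t=F+\check E+\kappa K^{-1}\in\mathbf U$, and define for $a\ge0$ $$\dot t^{(2a)}=\frac{1}{[2a]!}\prod_{j=-a+1}^{a}\bigl(t-[2j-1]\bigr),\qquad \dot t^{(2a+1)}=\frac{t}{[2a+1]!}\prod_{j=-a+1}^{a}\bigl(t-[2j-1]\bigr).$$ Then for every $m\ge0$, in $\mathbf U$, $$\dot t^{(2m)}=\sum_{b=0}^{2m}\sum_{a=0}^{b}\sum_{c\ge0} q^{\binom{2c}{2}+2c-b(2m-b-2c)-a(b-a)}\,\mathfrak p^{(2m-b-2c)}(\kappa)\;\check E^{(a)}\begin{bmatrix}h;1-m\\ c\end{bmatrix}K^{b-2m+2c}F^{(b-a)},$$ $$\dot t^{(2m+1)}=\sum_{b=0}^{2m+1}\sum_{a=0}^{b}\sum_{c\ge0} q^{\binom{2c}{2}-b(2m-b-2c+1)-a(b-a)}\,\mathfrak p^{(2m-b-2c+1)}(\kappa)\;\check E^{(a)}\begin{bmatrix}h;1-m\\ c\end{bmatrix}K^{b-2m+2c-1}F^{(b-a)}.$$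
   Context: $q$ is an indeterminate, $[n]=\frac{q^n-q^{-n}}{q-q^{-1}}$ for $n\in\mathbb Z$, $[n]!=[1]\cdots[n]$, $[0]!=1$. $\mathbf U$ is the $\mathbb Q(q)$-algebra generated by $E,F,K^{\pm1}$ with relations $KK^{-1}=K^{-1}K=1$, $EF-FE=\frac{K-K^{-1}}{q-q^{-1}}$, $KE=q^2EK$, $KF=q^{-2}FK$. Put $\check E=q^{-1}EK^{-1}$, $\check E^{(n)}=\check E^n/[n]!$, $F^{(n)}=F^n/[n]!$. For $a\in\mathbb Z$, $n\in\mathbb N$: $\begin{bmatrix}h;a\\ n\end{bmatrix}=\prod_{i=1}^{n}\frac{q^{4a+4i-4}K^{-2}-1}{q^{4i}-1}$ (equal to $1$ for $n=0$). The polynomials $\mathfrak p_n(x)$ are defined by $\mathfrak p_0=1$, $\mathfrak p_n=0$ for $n<0$, $\mathfrak p_{n+1}=x\,\mathfrak p_n+q^{2-2n}[n][n-2]\,\mathfrak p_{n-1}$ ($n\ge0$); $\mathfrak p^{(n)}=\mathfrak p_n/[n]!$ for $n\ge0$ and $\mathfrak p^{(n)}=0$ for $n<0$. *)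

theory Defs
  imports "HOL-Computational_Algebra.Polynomial" "HOL-Computational_Algebra.Fraction_Field"
begin

type_synonym qf = "rat poly fract"

definition qq :: qf where "qq = Fract [:0, 1:] 1"

definition qn :: "int \<Rightarrow> qf" where
  "qn n = (qq powi n - qq powi (- n)) / (qq - inverse qq)"

definition qfact :: "nat \<Rightarrow> qf" where
  "qfact n = (\<Prod>i\<in>{1..n}. qn (int i))"

fun pp :: "qf \<Rightarrow> nat \<Rightarrow> qf" where
  "pp x 0 = 1"
| "pp x (Suc 0) = x"
| "pp x (Suc (Suc n)) =
     x * pp x (Suc n) + qq powi (2 - 2 * int (Suc n)) * qn (int (Suc n)) * qn (int (Suc n) - 2) * pp x n"

definition pdiv :: "qf \<Rightarrow> int \<Rightarrow> qf" where
  "pdiv x n = (if n < 0 then 0 else pp x (nat n) / qfact (nat n))"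

text \<open>A Q(q)-algebra A (structure map phi: Q(q) -> A, a unital ring homomorphism
  with central image) together with elements E, F, K, Ki satisfying the defining
  relations of U.  Identities in U are exactly the identities holding for all such data.\<close>
definition Uq_alg :: "(qf \<Rightarrow> 'a::ring_1) \<Rightarrow> 'a \<Rightarrow> 'a \<Rightarrow> 'a \<Rightarrow> 'a \<Rightarrow> bool" where
  "Uq_alg \<phi> E F K Ki \<longleftrightarrow>
     \<phi> 1 = 1 \<and> (\<forall>x y. \<phi> (x + y) = \<phi> x + \<phi> y) \<and> (\<forall>x y. \<phi> (x * y) = \<phi> x * \<phi> y) \<and>
     (\<forall>c x. \<phi> c * x = x * \<phi> c) \<and>
     K * Ki = 1 \<and> Ki * K = 1 \<and>
     E * F - F * E = \<phi> (inverse (qq - inverse qq)) * (K - Ki) \<and>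
     K * E = \<phi> (qq ^ 2) * E * K \<and>
     K * F = \<phi> (qq powi (-2)) * F * K"

definition kpow :: "'a::ring_1 \<Rightarrow> 'a \<Rightarrow> int \<Rightarrow> 'a" where
  "kpow K Ki n = (if 0 \<le> n then K ^ nat n else Ki ^ nat (- n))"

definition Echeck :: "(qf \<Rightarrow> 'a::ring_1) \<Rightarrow> 'a \<Rightarrow> 'a \<Rightarrow> 'a" where
  "Echeck \<phi> E Ki = \<phi> (inverse qq) * E * Ki"

definition dpow :: "(qf \<Rightarrow> 'a::ring_1) \<Rightarrow> 'a \<Rightarrow> nat \<Rightarrow> 'a" where
  "dpow \<phi> X n = \<phi> (inverse (qfact n)) * X ^ n"

definition hbin :: "(qf \<Rightarrow> 'a::ring_1) \<Rightarrow> 'a \<Rightarrow> int \<Rightarrow> nat \<Rightarrow> 'a" where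
  "hbin \<phi> Ki a n = prod_list (map (\<lambda>i.
       (\<phi> (qq powi (4 * a + 4 * int i - 4)) * Ki ^ 2 - 1) * \<phi> (inverse (qq ^ (4 * i) - 1))) [1..<n+1])"

definition tdot :: "(qf \<Rightarrow> 'a::ring_1) \<Rightarrow> 'a \<Rightarrow> nat \<Rightarrow> 'a" where
  "tdot \<phi> t n = \<phi> (inverse (qfact n)) * (if odd n then t else 1) *
     prod_list (map (\<lambda>j. t - \<phi> (qn (2 * j - 1))) [- int (n div 2) + 1 .. int (n div 2)])"

end

theory Submission
  imports Defs
begin

text \<open>
  Since \<open>t \<cdot> t^(2m) = [2m+1] t^(2m+1)\<close> and
  \<open>t \<cdot> t^(2m+1) = [2m+2] t^(2m+2) + [2m+1] t^(2m)\<close>, it suffices that the right-hand sides obey the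
  same recursion. Multiply such a sum by \<open>t = F + X + \<kappa> K^-1\<close>, where \<open>X\<close> is the element written E with a
  check, and move everything into the order \<open>X\<close>, \<open>K^-1\<close>, \<open>F\<close> by
  \<open>F X^(a) = q^(-2a) X^(a) F + X^(a-1) (q^(3-3a) K^-2 - q^(1-a)) / (q^2 - 1)\<close>,
  absorbing \<open>\<kappa>\<close> by the recursion of the polynomials \<open>p^(j)\<close>. After this substitution the
  coefficients of \<open>X^(a) p^(j) F^(d)\<close> already agree one by one: up to a common factor
  they are affine in \<open>K^-2\<close>, which leaves two identities in \<open>Q(q)\<close> for each parity.
\<close>

section \<open>Scalars and finite sums\<close>

text \<open>Represents powers of q as monomials, whose degrees then show that q is not a root of
  unity; hence neither [n] nor q^(4n) - 1 vanishes for n > 0.\<close>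

lemma qq_power: "qq ^ n = Fract (monom 1 n) 1"
proof (induction n)
  case 0
  then show ?case by (simp add: One_fract_def monom_0 one_pCons)
next
  case (Suc n)
  then show ?case by (simp add: qq_def monom_Suc)
qed

lemma qq_nonzero [simp]: "qq \<noteq> 0"
  by (simp add: qq_def Zero_fract_def eq_fract)

lemma qq_power_eq_1_iff [simp]: "qq ^ n = 1 \<longleftrightarrow> n = 0"
proof
  assume "qq ^ n = 1"
  then have "monom (1::rat) n = 1"
    by (simp add: qq_power One_fract_def eq_fract)
  then have "degree (monom (1::rat) n) = 0" by simp
  then show "n = 0" by (simp add: degree_monom_eq)
qed simp

lemma qq_diff_inverse_nonzero: "qq - inverse qq \<noteq> 0"
proof
  assume "qq - inverse qq = 0"
  then have "qq ^ 2 = 1" by (simp add: power2_eq_square field_simps)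
  then show False by simp
qed

lemma qn_0 [simp]: "qn 0 = 0"
  by (simp add: qn_def)

lemma qn_1 [simp]: "qn 1 = 1"
  using qq_diff_inverse_nonzero by (simp add: qn_def)

lemma qn_minus: "qn (- n) = - qn n"
  by (simp add: qn_def minus_divide_left)

lemma qn_nonzero: "n > 0 \<Longrightarrow> qn (int n) \<noteq> 0"
proof
  assume n: "n > 0" and "qn (int n) = 0"
  then have "qq ^ n = inverse (qq ^ n)"
    using qq_diff_inverse_nonzero by (simp add: qn_def power_int_minus)
  then have "qq ^ (n + n) = 1" by (simp add: power_add field_simps)
  then show False using n by (simp only: qq_power_eq_1_iff)
qed

lemma qfact_0 [simp]: "qfact 0 = 1"
  by (simp add: qfact_def)

lemma qfact_Suc: "qfact (Suc n) = qn (int (Suc n)) * qfact n"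
  by (simp add: qfact_def mult.commute)

lemma qfact_nonzero [simp]: "qfact n \<noteq> 0"
  by (induction n) (simp_all add: qfact_Suc qn_nonzero del: of_nat_Suc)

lemma pdiv_neg [simp]: "n < 0 \<Longrightarrow> pdiv x n = 0"
  by (simp add: pdiv_def)

text \<open>This is the defining recursion of the polynomials divided by [j]!. It persists for all
  integers \<open>j\<close>: at \<open>j = -1\<close> the factor [0] removes the constant
  polynomial, and at \<open>j = 0\<close> the last term contains
  \<open>pdiv x (-1) = 0\<close>.\<close>

lemma pdiv_rec:
  "x * pdiv x j = qn (j + 1) * pdiv x (j + 1) - qq powi (2 - 2 * j) * qn (j - 2) * pdiv x (j - 1)"
proof -
  consider "j < -1" | "j = -1" | "j = 0" | i where "j = int (Suc i)"
  proof -
    have "j < -1 \<or> j = -1 \<or> j = 0 \<or> j = int (Suc (nat (j - 1)))" by linarith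
    then show thesis using that by blast
  qed
  then show ?thesis
  proof cases
    case 4
    have "nat (1 + int i) = Suc i" "nat (2 + int i) = Suc (Suc i)" by simp_all
    moreover have "qn (int (Suc i)) \<noteq> 0" "qn (int (Suc (Suc i))) \<noteq> 0"
      by (rule qn_nonzero; simp)+
    ultimately show ?thesis using 4
      by (simp add: pdiv_def qfact_Suc divide_simps del: of_nat_Suc)
         (simp add: qfact_Suc algebra_simps)
  qed (simp_all add: pdiv_def qfact_Suc)
qed

section \<open>Coefficient identities in Q(q)\<close>

lemma power_int_numeral_mult:
  "x \<noteq> 0 \<Longrightarrow> x powi (numeral k * n) = (x powi n :: 'b :: field) ^ numeral k"
  by (metis mult.commute power_int_mult power_int_numeral)

lemmas powi_expand = power_int_add power_int_diff power_int_minus power_int_numeral_mult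

text \<open>Over the denominator q - q^-1 the three products are consecutive differences of
  q^(J+a+d), q^(J+d-a), q^(d-J-a), q^(-J-a-d), so the middle powers cancel. This settles the
  comparison of coefficients at \<open>c = 0\<close>.\<close>

lemma qn_telescope:
  "qn a * qq powi (J + d) + qn J * qq powi (d - a) + qn d * qq powi (- J - a) = qn (J + a + d)"
  using qq_diff_inverse_nonzero
  by (simp add: qn_def powi_expand divide_simps) (simp add: algebra_simps)

text \<open>Put S = J + a + d. The bracket telescopes to q^(2c) [S]; moreover [S+2c] - q^(2c) [S] =
  q^(-S) [2c] and [2c] / (q^(4c) - 1) = q^(1-2c) / (q^2 - 1).\<close>

lemma coeff_even_const:
  assumes "qq powi (4 * c) \<noteq> 1"
  shows "(qn a * qq powi (2 * c + J + d) + qn J * qq powi (2 * c - a + d)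
    + qn d * qq powi (2 * c - J - a)) / (qq powi (4 * c) - 1)
    + qq powi (1 - 2 * c - J - d - a) / (qq ^ 2 - 1)
    = qn (J + a + d + 2 * c) / (qq powi (4 * c) - 1)"
proof -
  \<comment> \<open>All powers of q become monomials in q, x, y, z, u, so the claim is an identity
    of rational functions, checked by clearing denominators.\<close>
  define x y z u where "x = qq powi a" "y = qq powi d" "z = qq powi c" "u = qq powi J"
  have [simp]: "x \<noteq> 0" "y \<noteq> 0" "z \<noteq> 0" "u \<noteq> 0" by (simp_all add: x_y_z_u_def)
  have z: "z ^ 4 - 1 \<noteq> 0" using assms by (simp add: x_y_z_u_def power_int_numeral_mult)
  have q: "qq ^ 2 - 1 \<noteq> 0" by simp
  have qd: "qq - inverse qq = (qq ^ 2 - 1) / qq" by (simp add: field_simps power2_eq_square)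
  show ?thesis
    using z q
    by (simp add: qn_def powi_expand qd flip: x_y_z_u_def)
       (simp add: divide_simps, simp add: algebra_simps power2_eq_square power4_eq_xxxx)
qed

text \<open>The companion for the coefficient of K^-2. Here
  \<open>2 * (J + a + d + 2 * c - 1)\<close> is 4m, so q^(4c-4m) and q^(-4m) are the powers of q in
  the numerators of the factors by which [h;1-m] and [h;-m] of length c differ from [h;1-m] of
  length c - 1.\<close>

lemma coeff_even_square:
  assumes "qq powi (4 * c) \<noteq> 1"
  shows "((qn a * qq powi (2 * c + J + d) + qn J * qq powi (2 * c - a + d))
      * qq powi (4 * c - 2 * (J + a + d + 2 * c - 1))
    + qn d * qq powi (2 * c - J - a) * qq powi (- (2 * (J + a + d + 2 * c - 1))))
      / (qq powi (4 * c) - 1)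
    - qn (J - 1) * qq powi (1 - 2 * c - 3 * a - d - 2 * J)
    + qq powi (1 - 2 * c - J - d - 3 * a) / (qq ^ 2 - 1)
    = qn (J + a + d + 2 * c) * qq powi (4 * c - 2 * (J + a + d + 2 * c - 1)) / (qq powi (4 * c) - 1)"
proof -
  define x y z u where "x = qq powi a" "y = qq powi d" "z = qq powi c" "u = qq powi J"
  have [simp]: "x \<noteq> 0" "y \<noteq> 0" "z \<noteq> 0" "u \<noteq> 0" by (simp_all add: x_y_z_u_def)
  have z: "z ^ 4 - 1 \<noteq> 0" using assms by (simp add: x_y_z_u_def power_int_numeral_mult)
  have q: "qq ^ 2 - 1 \<noteq> 0" by simp
  have qd: "qq - inverse qq = (qq ^ 2 - 1) / qq" by (simp add: field_simps power2_eq_square)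
  show ?thesis
    using z q
    by (simp add: qn_def powi_expand qd flip: x_y_z_u_def)
       (simp add: divide_simps, simp add: algebra_simps eval_nat_numeral)
qed

text \<open>Now J + a + d + 2c = 2m + 2, and the bracket telescopes to q^(-2c) [J+a+d]. The extra
  summand with [2m+1] accounts for the term [2m+1] t^(2m) of the recursion.\<close>

lemma coeff_odd_const:
  assumes "qq powi (4 * c) \<noteq> 1"
  shows "(qn a * qq powi (J + d - 2 * c) + qn J * qq powi (d - a - 2 * c)
    + qn d * qq powi (- 2 * c - J - a)) / (qq powi (4 * c) - 1)
    + qq powi (3 - 6 * c - J - d - a) / (qq ^ 2 - 1)
    = qn (J + a + d + 2 * c) / (qq powi (4 * c) - 1)
      - qn (J + a + d + 2 * c - 1) * qq powi (1 - 4 * c)"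
proof -
  define x y z u where "x = qq powi a" "y = qq powi d" "z = qq powi c" "u = qq powi J"
  have [simp]: "x \<noteq> 0" "y \<noteq> 0" "z \<noteq> 0" "u \<noteq> 0" by (simp_all add: x_y_z_u_def)
  have z: "z ^ 4 - 1 \<noteq> 0" using assms by (simp add: x_y_z_u_def power_int_numeral_mult)
  have q: "qq ^ 2 - 1 \<noteq> 0" by simp
  have qd: "qq - inverse qq = (qq ^ 2 - 1) / qq" by (simp add: field_simps power2_eq_square)
  show ?thesis
    using z q
    by (simp add: qn_def powi_expand qd flip: x_y_z_u_def)
       (simp add: divide_simps, simp add: algebra_simps eval_nat_numeral)
qed

text \<open>The contribution of t^(2m) carries no further factor K^-2, so it is absent from this
  coefficient; \<open>2 * (J + a + d + 2 * c - 2)\<close> is again 4m.\<close>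

lemma coeff_odd_square:
  assumes "qq powi (4 * c) \<noteq> 1"
  shows "((qn a * qq powi (J + d - 2 * c) + qn J * qq powi (d - a - 2 * c))
      * qq powi (4 * c - 2 * (J + a + d + 2 * c - 2))
    + qn d * qq powi (- 2 * c - J - a) * qq powi (- (2 * (J + a + d + 2 * c - 2))))
      / (qq powi (4 * c) - 1)
    - qn (J - 1) * qq powi (3 - 6 * c - 3 * a - d - 2 * J)
    + qq powi (3 - 6 * c - J - d - 3 * a) / (qq ^ 2 - 1)
    = qn (J + a + d + 2 * c) * qq powi (- (2 * (J + a + d + 2 * c - 2))) / (qq powi (4 * c) - 1)"
proof -
  define x y z u where "x = qq powi a" "y = qq powi d" "z = qq powi c" "u = qq powi J"
  have [simp]: "x \<noteq> 0" "y \<noteq> 0" "z \<noteq> 0" "u \<noteq> 0" by (simp_all add: x_y_z_u_def)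
  have z: "z ^ 4 - 1 \<noteq> 0" using assms by (simp add: x_y_z_u_def power_int_numeral_mult)
  have q: "qq ^ 2 - 1 \<noteq> 0" by simp
  have qd: "qq - inverse qq = (qq ^ 2 - 1) / qq" by (simp add: field_simps power2_eq_square)
  show ?thesis
    using z q
    by (simp add: qn_def powi_expand qd flip: x_y_z_u_def)
       (simp add: divide_simps, simp add: algebra_simps eval_nat_numeral)
qed

section \<open>Index shifts, weights and regions of summation\<close>

lemma sum_atMost_shift_up:
  "f 0 = 0 \<Longrightarrow> f (Suc N) = 0 \<Longrightarrow> (\<Sum>i\<le>N. f (Suc i)) = (\<Sum>i\<le>N. f i :: 'b :: ab_group_add)"
  using sum.atMost_Suc_shift[of f N] by simp

lemma sum_atMost_shift_down:
  "g N = 0 \<Longrightarrow> (\<Sum>i\<le>N. case i of 0 \<Rightarrow> 0 | Suc i \<Rightarrow> g i) = (\<Sum>i\<le>N. g i :: 'b :: ab_group_add)"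
  using sum.atMost_Suc_shift[of "\<lambda>i. case i of 0 \<Rightarrow> 0 | Suc i \<Rightarrow> g i" "N - 1"]
  by (cases N) simp_all

text \<open>The weights of the theorem for \<open>b = a + d\<close>: \<open>\<epsilon> = 1\<close> if \<open>n\<close> is even, \<open>\<epsilon> = -1\<close> if \<open>n\<close> is odd.\<close>

definition wt :: "int \<Rightarrow> int \<Rightarrow> int \<Rightarrow> int \<Rightarrow> int \<Rightarrow> qf" where
  "wt \<epsilon> n a d c = qq powi (2 * c ^ 2 + \<epsilon> * c - (a + d) * (n - a - d - 2 * c) - a * d)"

text \<open>Reduces the ratio of two neighbouring weights to a polynomial identity between integer
  exponents.\<close>

lemma wt_shift:
  assumes "2 * c ^ 2 + \<epsilon> * c - (a + d) * (n - a - d - 2 * c) - a * d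
    = 2 * c' ^ 2 + \<epsilon>' * c' - (a' + d') * (n' - a' - d' - 2 * c') - a' * d' + e"
  shows "wt \<epsilon> n a d c = wt \<epsilon>' n' a' d' c' * qq powi e"
  unfolding wt_def assms by (simp add: power_int_add)

text \<open>The cube contains every nonzero term. The bound \<open>n \<le> 2 * M + 1\<close> forces
  2c > n for c > M, so the inner sum may stop at \<open>M\<close>; the same \<open>M = m\<close>
  thus serves both parities.\<close>

lemma sum_box_eq_triangle:
  fixes f :: "nat \<Rightarrow> nat \<Rightarrow> nat \<Rightarrow> 'b :: comm_monoid_add"
  assumes zero: "\<And>a d c. n < a + d + 2 * c \<Longrightarrow> f a d c = 0"
    and "n \<le> N" "M \<le> N" "n \<le> 2 * M + 1"
  shows "(\<Sum>a\<le>N. \<Sum>d\<le>N. \<Sum>c\<le>N. f a d c) = (\<Sum>b = 0..n. \<Sum>a = 0..b. \<Sum>c = 0..M. f a (b - a) c)"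
proof -
  define g where "g a d = (\<Sum>c = 0..M. f a d c)" for a d
  have "(\<Sum>c\<le>N. f a d c) = g a d" for a d
    unfolding g_def using assms by (intro sum.mono_neutral_right) (auto intro!: zero)
  then have "(\<Sum>a\<le>N. \<Sum>d\<le>N. \<Sum>c\<le>N. f a d c) = (\<Sum>(a, d)\<in>{..N} \<times> {..N}. g a d)"
    by (simp add: sum.cartesian_product)
  also have "\<dots> = (\<Sum>(a, d)\<in>{(a, d). a + d \<le> n}. g a d)"
  proof (rule sum.mono_neutral_right)
    show "\<forall>i\<in>{..N} \<times> {..N} - {(a, d). a + d \<le> n}. (case i of (a, d) \<Rightarrow> g a d) = 0"
      by (auto simp: g_def intro!: sum.neutral zero)
  qed (use assms in auto)
  also have "\<dots> = (\<Sum>b = 0..n. \<Sum>a = 0..b. g a (b - a))"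
    by (simp add: sum.triangle_reindex_eq atMost_atLeast0)
  finally show ?thesis unfolding g_def .
qed

section \<open>Commutation relations\<close>

locale Uq =
  fixes \<phi> :: "qf \<Rightarrow> 'a::ring_1" and E F K Ki :: 'a
  assumes Uq_alg: "Uq_alg \<phi> E F K Ki"
begin

lemma phi_1 [simp]: "\<phi> 1 = 1"
  and phi_add: "\<phi> (x + y) = \<phi> x + \<phi> y"
  and phi_mult: "\<phi> (x * y) = \<phi> x * \<phi> y"
  and phi_central: "\<phi> c * z = z * \<phi> c"
  and K_Ki: "K * Ki = 1" and Ki_K: "Ki * K = 1"
  and E_F: "E * F - F * E = \<phi> (inverse (qq - inverse qq)) * (K - Ki)"
  and K_E: "K * E = \<phi> (qq ^ 2) * E * K"
  and K_F: "K * F = \<phi> (qq powi (-2)) * F * K"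
  using Uq_alg unfolding Uq_alg_def by blast+

lemma phi_0 [simp]: "\<phi> 0 = 0"
  using phi_add[of 0 0] by simp

lemma phi_uminus: "\<phi> (- x) = - \<phi> x"
  using phi_add[of x "- x"] by (simp add: add_eq_0_iff)

lemma phi_diff: "\<phi> (x - y) = \<phi> x - \<phi> y"
  using phi_add[of x "- y"] by (simp add: phi_uminus)

lemma phi_left_commute: "z * (\<phi> c * v) = \<phi> c * (z * v)"
  by (metis phi_central mult.assoc)

lemma phi_merge: "\<phi> x * (\<phi> y * z) = \<phi> (x * y) * z"
  by (simp add: phi_mult mult.assoc)

abbreviation X where "X \<equiv> Echeck \<phi> E Ki"

text \<open>Collects scalars on the left. The rules are instantiated at fixed non-scalar elements,
  because as a rewrite rule the general form could exchange two scalars indefinitely.\<close>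

lemmas phi_out = phi_left_commute[of F] phi_left_commute[of X] phi_left_commute[of Ki]
  phi_left_commute[of E] phi_left_commute[of "z ^ n" for z n]
  phi_central[of _ F, symmetric] phi_central[of _ X, symmetric] phi_central[of _ Ki, symmetric]
  phi_central[of _ E, symmetric] phi_central[of _ "z ^ n" for z n, symmetric]

section \<open>Moving K^-1 and F past E and its powers\<close>

lemma Ki_E: "Ki * E = \<phi> (qq powi (-2)) * (E * Ki)"
proof -
  have "E * Ki = Ki * (K * E) * Ki"
    by (metis Ki_K mult.assoc mult_1)
  also have "\<dots> = \<phi> (qq ^ 2) * (Ki * E)"
    by (simp add: K_E mult.assoc K_Ki phi_out)
  finally show ?thesis
    by (simp add: phi_merge power_int_minus)
qed

lemma F_Ki: "F * Ki = \<phi> (qq powi (-2)) * (Ki * F)"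
proof -
  have "F * Ki = Ki * (K * F) * Ki"
    by (metis Ki_K mult.assoc mult_1)
  also have "\<dots> = \<phi> (qq powi (-2)) * (Ki * F)"
    by (simp add: K_F mult.assoc K_Ki phi_out)
  finally show ?thesis .
qed

lemma Ki_X: "Ki * X = \<phi> (qq powi (-2)) * (X * Ki)"
proof -
  have "Ki * X = \<phi> (inverse qq) * ((Ki * E) * Ki)"
    by (simp add: Echeck_def mult.assoc phi_out)
  also have "\<dots> = \<phi> (qq powi (-2)) * (X * Ki)"
    by (simp add: Ki_E Echeck_def mult.assoc phi_merge mult.commute[of "qq powi (- 2)"])
  finally show ?thesis .
qed

text \<open>The factor K^-1 in \<open>X\<close> turns the commutator K - K^-1 into 1 - K^-2, and
  q^-1 / (q - q^-1) = 1 / (q^2 - 1).\<close>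

lemma F_X: "F * X = \<phi> (qq powi (-2)) * (X * F) + \<phi> (inverse (qq ^ 2 - 1)) * (Ki ^ 2 - 1)"
proof -
  define \<delta> where "\<delta> = inverse (qq - inverse qq)"
  have FE: "F * E = E * F - \<phi> \<delta> * (K - Ki)"
    using E_F by (simp add: \<delta>_def algebra_simps)
  have "F * X = \<phi> (inverse qq) * ((F * E) * Ki)"
    by (simp add: Echeck_def mult.assoc phi_out)
  also have "\<dots> = \<phi> (inverse qq) * (E * (F * Ki)) - \<phi> (inverse qq * \<delta>) * (1 - Ki ^ 2)"
    by (simp add: FE K_Ki power2_eq_square phi_mult mult.assoc left_diff_distrib right_diff_distrib)
  also have "\<phi> (inverse qq) * (E * (F * Ki)) = \<phi> (qq powi (-2)) * (X * F)"
    by (simp add: F_Ki Echeck_def mult.assoc phi_merge phi_out mult.commute[of "qq powi (- 2)"])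
  also have "inverse qq * \<delta> = inverse (qq ^ 2 - 1)"
    by (simp add: \<delta>_def power2_eq_square field_simps)
  finally show ?thesis by (simp add: right_diff_distrib)
qed

lemma Ki_X': "Ki * (X * z) = \<phi> (qq powi (-2)) * (X * (Ki * z))"
  by (metis Ki_X mult.assoc)

lemma F_Ki': "F * (Ki * z) = \<phi> (qq powi (-2)) * (Ki * (F * z))"
  by (metis F_Ki mult.assoc)

lemma Ki2_X: "Ki ^ 2 * X = \<phi> (qq powi (-4)) * (X * Ki ^ 2)"
proof -
  have "Ki ^ 2 * X = \<phi> (qq powi (-2) * qq powi (-2)) * (X * Ki ^ 2)"
    by (simp add: power2_eq_square mult.assoc Ki_X Ki_X' phi_out phi_merge)
  then show ?thesis by (simp flip: power_int_add)
qed

lemma F_Ki_power: "F * Ki ^ n = \<phi> (qq powi (- 2 * int n)) * (Ki ^ n * F)"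
proof (induction n)
  case (Suc n)
  have "F * Ki ^ Suc n = \<phi> (qq powi (-2)) * (Ki * (F * Ki ^ n))"
    by (simp add: F_Ki')
  also have "\<dots> = \<phi> (qq powi (-2) * qq powi (- 2 * int n)) * (Ki ^ Suc n * F)"
    by (simp add: Suc phi_out phi_merge mult.assoc)
  also have "qq powi (-2) * qq powi (- 2 * int n) = qq powi (- 2 * int (Suc n))"
    by (simp flip: power_int_add)
  finally show ?case .
qed simp

lemma Ki_X_power: "Ki * X ^ n = \<phi> (qq powi (- 2 * int n)) * (X ^ n * Ki)"
proof (induction n)
  case (Suc n)
  have "Ki * X ^ Suc n = \<phi> (qq powi (-2)) * (X * (Ki * X ^ n))"
    by (simp add: Ki_X')
  also have "\<dots> = \<phi> (qq powi (-2) * qq powi (- 2 * int n)) * (X ^ Suc n * Ki)"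
    by (simp add: Suc phi_out phi_merge mult.assoc)
  also have "qq powi (-2) * qq powi (- 2 * int n) = qq powi (- 2 * int (Suc n))"
    by (simp flip: power_int_add)
  finally show ?case .
qed simp

text \<open>Moving \<open>F\<close> past the last \<open>X\<close> adds one commutator, and moving
  K^-2 past it costs q^-4. Up to 1 / (q^2 - 1), the constant coefficient is therefore the sum of
  q^(-2k), and that of K^-2 the sum of q^(2k-4n), over k from 0 to n.\<close>

lemma F_X_power:
  "F * X ^ Suc n = \<phi> (qq powi (- 2 * int (Suc n))) * (X ^ Suc n * F)
    + X ^ n * (\<phi> (qn (int (Suc n)) * qq powi (- 3 * int n) / (qq ^ 2 - 1)) * Ki ^ 2
      - \<phi> (qn (int (Suc n)) * qq powi (- int n) / (qq ^ 2 - 1)))"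
proof (induction n)
  case 0
  show ?case by (simp add: F_X divide_inverse right_diff_distrib)
next
  case (Suc n)
  define \<alpha> \<beta> \<gamma> \<epsilon> where "\<alpha> = qn (int (Suc n)) * qq powi (- 3 * int n) / (qq ^ 2 - 1)"
    and "\<beta> = qn (int (Suc n)) * qq powi (- int n) / (qq ^ 2 - 1)"
    and "\<gamma> = inverse (qq ^ 2 - 1)"
    and "\<epsilon> = qq powi (- 2 * int (Suc n))"
  have "F * X ^ Suc (Suc n) = (F * X ^ Suc n) * X"
    by (metis power_Suc2 mult.assoc)
  also have "\<dots> = \<phi> \<epsilon> * (X ^ Suc n * (F * X)) + X ^ n * (\<phi> \<alpha> * (Ki ^ 2 * X) - \<phi> \<beta> * X)"
    unfolding Suc.IH \<alpha>_def[symmetric] \<beta>_def[symmetric] \<epsilon>_def[symmetric]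
    by (simp add: distrib_right left_diff_distrib mult.assoc del: power_Suc)
  also have "\<phi> \<epsilon> * (X ^ Suc n * (F * X)) = \<phi> (\<epsilon> * qq powi (-2)) * (X ^ Suc n * X * F)
      + X ^ Suc n * (\<phi> (\<epsilon> * \<gamma>) * Ki ^ 2 - \<phi> (\<epsilon> * \<gamma>))"
    unfolding F_X \<gamma>_def[symmetric]
    by (simp add: distrib_left right_diff_distrib phi_out phi_merge mult.assoc phi_mult[symmetric] del: power_Suc)
  also have "X ^ n * (\<phi> \<alpha> * (Ki ^ 2 * X) - \<phi> \<beta> * X)
      = X ^ Suc n * (\<phi> (\<alpha> * qq powi (-4)) * Ki ^ 2 - \<phi> \<beta>)"
    unfolding Ki2_X power_Suc2
    by (simp add: right_diff_distrib phi_out phi_merge mult.assoc)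
  also have "X ^ Suc n * X = X ^ Suc (Suc n)"
    by (metis power_Suc2)
  also have "\<epsilon> * qq powi (-2) = qq powi (- 2 * int (Suc (Suc n)))"
    by (simp add: \<epsilon>_def flip: power_int_add)
  finally have *: "F * X ^ Suc (Suc n) = \<phi> (qq powi (- 2 * int (Suc (Suc n)))) * (X ^ Suc (Suc n) * F)
     + X ^ Suc n * (\<phi> (\<epsilon> * \<gamma> + \<alpha> * qq powi (-4)) * Ki ^ 2 - \<phi> (\<epsilon> * \<gamma> + \<beta>))"
    by (simp add: phi_add distrib_left distrib_right right_diff_distrib left_diff_distrib
        algebra_simps del: power_Suc)
  define z where "z = qq powi (int n)"
  have z: "z \<noteq> 0" by (simp add: z_def)
  have q: "qq ^ 2 - 1 \<noteq> 0" by simp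
  have qd: "qq - inverse qq = (qq ^ 2 - 1) / qq" by (simp add: field_simps power2_eq_square)
  have nz: "int (Suc n) = int n + 1" "int (Suc (Suc n)) = int n + 2" by simp_all
  have m: "- (k::int) * x = - (k * x)" for k x by simp
  have n4: "qq powi (-4) = inverse (qq ^ 4)" by (simp add: power_int_minus)
  have "\<epsilon> * \<gamma> + \<alpha> * qq powi (-4)
      = qn (int (Suc (Suc n))) * qq powi (- 3 * int (Suc n)) / (qq ^ 2 - 1)"
    unfolding \<epsilon>_def \<gamma>_def \<alpha>_def qn_def nz m n4 qd using z q
    by (simp add: powi_expand flip: z_def del: power_int_of_nat)
       (simp add: divide_simps, simp add: algebra_simps eval_nat_numeral)
  moreover have "\<epsilon> * \<gamma> + \<beta> = qn (int (Suc (Suc n))) * qq powi (- int (Suc n)) / (qq ^ 2 - 1)"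
    unfolding \<epsilon>_def \<gamma>_def \<beta>_def qn_def nz m qd using z q
    by (simp add: powi_expand flip: z_def del: power_int_of_nat)
       (simp add: divide_simps, simp add: algebra_simps eval_nat_numeral)
  ultimately show ?case using * by simp
qed


section \<open>Divided powers\<close>

lemma mult_dpow: "Y * dpow \<phi> Y n = \<phi> (qn (int (Suc n))) * dpow \<phi> Y (Suc n)"
proof -
  have "qn (int (Suc n)) * inverse (qfact (Suc n)) = inverse (qfact n)"
    using qn_nonzero[of "Suc n"] by (simp add: qfact_Suc del: of_nat_Suc)
  then show ?thesis
    by (simp add: dpow_def phi_left_commute[of Y] phi_merge del: of_nat_Suc)
qed

abbreviation A where "A \<equiv> dpow \<phi> X"
abbreviation B where "B \<equiv> dpow \<phi> F"

lemma Ki_A: "Ki * A n = \<phi> (qq powi (- 2 * int n)) * (A n * Ki)"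
  by (simp add: dpow_def phi_out Ki_X_power mult.assoc phi_merge mult.commute[of "inverse (qfact n)"])

lemma F_A_0: "F * A 0 = A 0 * F"
  by (simp add: dpow_def)

text \<open>The factor [n+1] in \<open>F_X_power\<close> turns 1/[n+1]! into 1/[n]!, so the
  commutator term is exactly a lower divided power.\<close>

lemma F_A_Suc:
  "F * A (Suc n) = \<phi> (qq powi (- 2 * int (Suc n))) * (A (Suc n) * F)
    + A n * (\<phi> (qq powi (- 3 * int n) / (qq ^ 2 - 1)) * Ki ^ 2 - \<phi> (qq powi (- int n) / (qq ^ 2 - 1)))"
proof -
  define \<alpha> \<beta> \<epsilon> where "\<alpha> = qq powi (- 3 * int n) / (qq ^ 2 - 1)"
    and "\<beta> = qq powi (- int n) / (qq ^ 2 - 1)" and "\<epsilon> = qq powi (- 2 * int (Suc n))"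
  define i g where "i = inverse (qfact (Suc n))" and "g = qn (int (Suc n))"
  have i: "i * g = inverse (qfact n)"
    using qn_nonzero[of "Suc n"] by (simp add: qfact_Suc i_def g_def del: of_nat_Suc)
  have "F * A (Suc n) = \<phi> i * (F * X ^ Suc n)"
    by (simp add: dpow_def phi_out i_def del: power_Suc)
  also have "F * X ^ Suc n = \<phi> \<epsilon> * (X ^ Suc n * F) + X ^ n * (\<phi> (g * \<alpha>) * Ki ^ 2 - \<phi> (g * \<beta>))"
    unfolding F_X_power \<alpha>_def \<beta>_def \<epsilon>_def g_def by simp
  also have "\<phi> i * (\<phi> \<epsilon> * (X ^ Suc n * F) + X ^ n * (\<phi> (g * \<alpha>) * Ki ^ 2 - \<phi> (g * \<beta>)))
      = \<phi> \<epsilon> * (\<phi> i * X ^ Suc n * F) + \<phi> (i * g) * X ^ n * (\<phi> \<alpha> * Ki ^ 2 - \<phi> \<beta>)"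
    by (simp add: distrib_left right_diff_distrib phi_out phi_merge mult.assoc mult.left_commute mult.commute[of i \<epsilon>]
        del: power_Suc)
  finally show ?thesis
    unfolding i unfolding i_def \<alpha>_def \<beta>_def \<epsilon>_def dpow_def .
qed

section \<open>The h-binomials\<close>

lemma hbin_0 [simp]: "hbin \<phi> Ki a 0 = 1"
  by (simp add: hbin_def)

text \<open>A single factor of an h-binomial, with the exponent in the numerator decoupled from the
  index in the denominator so that the two can be rearranged separately.\<close>

definition hfac :: "int \<Rightarrow> nat \<Rightarrow> 'a" where
  "hfac e n = (\<phi> (qq powi e) * Ki ^ 2 - 1) * \<phi> (inverse (qq ^ (4 * n) - 1))"

lemma hfac_eq:
  "hfac e n = \<phi> (qq powi e / (qq ^ (4 * n) - 1)) * Ki ^ 2 - \<phi> (1 / (qq ^ (4 * n) - 1))"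
  by (simp add: hfac_def left_diff_distrib mult.assoc phi_out phi_merge divide_inverse)

lemma hbin_Suc: "hbin \<phi> Ki a (Suc n) = hbin \<phi> Ki a n * hfac (4 * a + 4 * int n) (Suc n)"
  by (simp add: hbin_def hfac_def algebra_simps)

lemma Ki_hfac: "Ki * hfac e n = hfac e n * Ki"
  by (simp add: hfac_eq left_diff_distrib right_diff_distrib mult.assoc phi_out
      flip: power_Suc power_Suc2)

lemma Ki_hbin: "Ki * hbin \<phi> Ki a n = hbin \<phi> Ki a n * Ki"
  by (induction n) (simp_all add: hbin_Suc Ki_hfac mult.assoc, metis Ki_hfac mult.assoc)

lemma Ki2_hbin: "Ki ^ 2 * hbin \<phi> Ki a n = hbin \<phi> Ki a n * Ki ^ 2"
  by (metis Ki_hbin mult.assoc power2_eq_square)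

text \<open>The numerators are polynomials in K^-2 and commute, while the denominators are central
  scalars; hence denominators may be swapped.\<close>

lemma hfac_exchange: "hfac e i * hfac f j = hfac f i * hfac e j"
proof -
  have "Ki ^ 2 * Ki ^ 2 = Ki ^ 4" by (simp flip: power_add)
  then show ?thesis
    by (simp add: hfac_def left_diff_distrib right_diff_distrib mult.assoc phi_out phi_merge
        phi_mult[symmetric] algebra_simps)
qed

text \<open>The numerators on the left have exponents 4a-4, 4a, ..., 4a+4n-4, and all but the first
  occur in [h;a] of length n. Swapping denominators pairs the first numerator with the largest
  denominator.\<close>

lemma hbin_pred_Suc: "hbin \<phi> Ki (a - 1) (Suc n) = hbin \<phi> Ki a n * hfac (4 * a - 4) (Suc n)"
proof (induction n)
  case 0
  show ?case by (simp add: hbin_Suc algebra_simps)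
next
  case (Suc n)
  have "4 * (a - 1) + 4 * int (Suc n) = 4 * a + 4 * int n" by simp
  then have "hbin \<phi> Ki (a - 1) (Suc (Suc n))
      = hbin \<phi> Ki a n * (hfac (4 * a - 4) (Suc n) * hfac (4 * a + 4 * int n) (Suc (Suc n)))"
    unfolding hbin_Suc[of "a - 1" "Suc n"] Suc.IH by (simp add: mult.assoc)
  then show ?case unfolding hfac_exchange[of "4 * a - 4"] by (simp add: hbin_Suc mult.assoc)
qed

lemma F_hfac: "F * hfac e n = hfac (e - 4) n * F"
  using F_Ki_power[of 2]
  by (simp add: hfac_eq left_diff_distrib right_diff_distrib mult.assoc phi_out phi_merge
      power_int_diff power_int_minus divide_inverse mult.assoc mult.commute mult.left_commute)

text \<open>Since F K^-2 = q^-4 K^-2 F, every exponent 4a + 4i - 4 drops by 4, that is,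
  \<open>a\<close> drops by 1. This is how [h;-m] arises beside [h;1-m].\<close>

lemma F_hbin: "F * hbin \<phi> Ki a n = hbin \<phi> Ki (a - 1) n * F"
proof (induction n)
  case (Suc n)
  have "F * hbin \<phi> Ki a (Suc n) = hbin \<phi> Ki (a - 1) n * (F * hfac (4 * a + 4 * int n) (Suc n))"
    by (simp add: hbin_Suc Suc.IH flip: mult.assoc)
  then show ?case
    by (simp add: F_hfac hbin_Suc mult.assoc algebra_simps)
qed simp

text \<open>For \<open>j < 0\<close> the factor \<open>pdiv \<kappa> j\<close> vanishes, which makes the truncation \<open>nat j\<close> harmless
  and lets the identities below hold for all integers \<open>j\<close>.\<close>

definition P :: "qf \<Rightarrow> int \<Rightarrow> 'a" where
  "P \<kappa> j = \<phi> (pdiv \<kappa> j) * Ki ^ nat j"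

lemma P_neg [simp]: "j < 0 \<Longrightarrow> P \<kappa> j = 0"
  by (simp add: P_def)

lemma F_P: "F * P \<kappa> j = \<phi> (qq powi (- 2 * j)) * (P \<kappa> j * F)"
proof (cases "j < 0")
  case False
  then show ?thesis
    by (simp add: P_def phi_out F_Ki_power phi_merge mult.assoc mult.commute[of "pdiv \<kappa> j"])
qed simp

text \<open>Multiplication by \<kappa> K^-1 is absorbed through \<open>pdiv_rec\<close>; the term of
  lower degree needs K^-2 to restore the power of K^-1.\<close>

lemma kappa_Ki_P:
  "\<phi> \<kappa> * (Ki * P \<kappa> j) = \<phi> (qn (j + 1)) * P \<kappa> (j + 1)
    - \<phi> (qq powi (2 - 2 * j) * qn (j - 2)) * (Ki ^ 2 * P \<kappa> (j - 1))"
proof -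
  \<comment> \<open>For \<open>j < 1\<close> the truncation by \<open>nat\<close> can break the law
    of exponents, but then \<open>pdiv \<kappa> (j - 1)\<close> is 0.\<close>
  have *: "\<phi> (pdiv \<kappa> (j - 1)) * (Ki ^ 2 * Ki ^ nat (j - 1)) = \<phi> (pdiv \<kappa> (j - 1)) * Ki ^ nat (j + 1)"
  proof (cases "j < 1")
    case False
    then have "nat (j + 1) = 2 + nat (j - 1)" by simp
    then show ?thesis by (simp add: power2_eq_square mult.assoc)
  qed simp
  have "\<phi> \<kappa> * (Ki * P \<kappa> j) = \<phi> (\<kappa> * pdiv \<kappa> j) * Ki ^ nat (j + 1)"
  proof (cases "j < 0")
    case False
    then have "nat (j + 1) = Suc (nat j)" by simp
    then show ?thesis by (simp add: P_def phi_out phi_merge)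
  qed simp
  also have "\<dots> = \<phi> (qn (j + 1)) * P \<kappa> (j + 1)
    - \<phi> (qq powi (2 - 2 * j) * qn (j - 2)) * (\<phi> (pdiv \<kappa> (j - 1)) * Ki ^ nat (j + 1))"
    unfolding pdiv_rec phi_diff by (simp add: P_def left_diff_distrib phi_merge)
  finally show ?thesis
    unfolding P_def phi_left_commute[of "Ki ^ 2"] * .
qed


text \<open>\<open>X\<close> yields \<open>?x\<close>, and \<kappa> K^-1 yields
  \<open>?k1 - ?k2\<close> by \<open>kappa_Ki_P\<close>. \<open>F\<close> yields \<open>?f1\<close>
  when it passes everything and joins \<open>B d\<close>, and \<open>?f2\<close> through its
  commutator with \<open>A a\<close>. Only in \<open>?f1\<close> does \<open>F\<close> cross the
  h-binomial.\<close>

lemma t_mult_term: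
  fixes \<kappa> \<omega> :: qf and m j :: int
  shows "(F + X + \<phi> \<kappa> * Ki) * (A a * (\<phi> \<omega> * (hbin \<phi> Ki (1 - m) c * P \<kappa> j)) * B d) =
    A (Suc a) * (\<phi> (qn (int (Suc a)) * \<omega>) * (hbin \<phi> Ki (1 - m) c * P \<kappa> j)) * B d
    + A a * (\<phi> (qq powi (- 2 * int a) * qn (j + 1) * \<omega>) * (hbin \<phi> Ki (1 - m) c * P \<kappa> (j + 1))) * B d
    - A a * (\<phi> (qq powi (- 2 * int a) * qq powi (2 - 2 * j) * qn (j - 2) * \<omega>)
        * (Ki ^ 2 * (hbin \<phi> Ki (1 - m) c * P \<kappa> (j - 1)))) * B d
    + A a * (\<phi> (qq powi (- 2 * int a) * qq powi (- 2 * j) * qn (int (Suc d)) * \<omega>)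
        * (hbin \<phi> Ki (- m) c * P \<kappa> j)) * B (Suc d)
    + (case a of 0 \<Rightarrow> 0 | Suc i \<Rightarrow> A i * ((\<phi> (qq powi (- 3 * int i) / (qq ^ 2 - 1) * \<omega>) * Ki ^ 2
        - \<phi> (qq powi (- int i) / (qq ^ 2 - 1) * \<omega>)) * (hbin \<phi> Ki (1 - m) c * P \<kappa> j)) * B d)"
    (is "_ = ?x + ?k1 - ?k2 + ?f1 + ?f2")
proof -
  define H where "H = hbin \<phi> Ki (1 - m) c * P \<kappa> j"
  have x: "X * (A a * (\<phi> \<omega> * H) * B d) = ?x"
  proof -
    have "X * (A a * (\<phi> \<omega> * H) * B d) = (X * A a) * (\<phi> \<omega> * H) * B d"
      by (simp add: mult.assoc)
    also have "\<dots> = ?x"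
      unfolding mult_dpow H_def
      by (simp add: mult.assoc phi_left_commute[of "dpow _ _ _"] phi_merge del: of_nat_Suc)
    finally show ?thesis .
  qed
  have "(\<phi> \<kappa> * Ki) * (A a * (\<phi> \<omega> * H) * B d) = \<phi> \<kappa> * ((Ki * A a) * (\<phi> \<omega> * H) * B d)"
    by (simp add: mult.assoc)
  also have "\<dots> = A a * (\<phi> (qq powi (- 2 * int a) * \<omega>) * (\<phi> \<kappa> * (Ki * H))) * B d"
    unfolding Ki_A
    by (simp add: mult.assoc phi_out phi_left_commute[of "dpow _ _ _"] phi_merge
        mult.commute mult.left_commute)
  also have "\<phi> \<kappa> * (Ki * H) = hbin \<phi> Ki (1 - m) c * (\<phi> \<kappa> * (Ki * P \<kappa> j))"
    unfolding H_def by (metis Ki_hbin mult.assoc phi_left_commute)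
  also have "\<dots> = \<phi> (qn (j + 1)) * (hbin \<phi> Ki (1 - m) c * P \<kappa> (j + 1))
      - \<phi> (qq powi (2 - 2 * j) * qn (j - 2)) * (Ki ^ 2 * (hbin \<phi> Ki (1 - m) c * P \<kappa> (j - 1)))"
    unfolding kappa_Ki_P right_diff_distrib phi_left_commute[of "hbin _ _ _ _"]
    by (simp add: Ki2_hbin flip: mult.assoc[of "Ki ^ 2"]) (simp add: mult.assoc)
  finally have k: "(\<phi> \<kappa> * Ki) * (A a * (\<phi> \<omega> * H) * B d) = ?k1 - ?k2"
    by (simp add: right_diff_distrib left_diff_distrib phi_merge mult.assoc mult.commute mult.left_commute)
  define D where "D = (case a of 0 \<Rightarrow> 0 | Suc i \<Rightarrow> A i * (\<phi> (qq powi (- 3 * int i) / (qq ^ 2 - 1)) * Ki ^ 2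
        - \<phi> (qq powi (- int i) / (qq ^ 2 - 1))))"
  have FA: "F * A a = \<phi> (qq powi (- 2 * int a)) * (A a * F) + D"
    by (cases a) (simp_all add: D_def F_A_0 F_A_Suc del: of_nat_Suc)
  have FH: "F * H = \<phi> (qq powi (- 2 * j)) * (hbin \<phi> Ki (- m) c * P \<kappa> j * F)"
    unfolding H_def mult.assoc[symmetric] F_hbin
    by (simp add: mult.assoc F_P phi_left_commute[of "hbin _ _ _ _"])
  have "F * (A a * (\<phi> \<omega> * H) * B d) = (F * A a) * (\<phi> \<omega> * H) * B d"
    by (simp add: mult.assoc)
  also have "\<dots> = \<phi> (qq powi (- 2 * int a)) * (A a * (\<phi> \<omega> * (F * H)) * B d) + D * (\<phi> \<omega> * H) * B d"
    unfolding FA distrib_right by (simp add: mult.assoc phi_out)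
  also have "A a * (\<phi> \<omega> * (F * H)) * B d
      = A a * (\<phi> \<omega> * (\<phi> (qq powi (- 2 * j)) * (hbin \<phi> Ki (- m) c * P \<kappa> j))) * (F * B d)"
    unfolding FH by (simp add: mult.assoc)
  also have "\<phi> (qq powi (- 2 * int a)) * \<dots> = ?f1"
    unfolding mult_dpow
    by (simp add: mult.assoc phi_left_commute[of "dpow _ _ _"] phi_left_commute[of "hbin _ _ _ _"]
        phi_left_commute[of "P _ _"] phi_merge mult.commute mult.left_commute del: of_nat_Suc)
  also have "D * (\<phi> \<omega> * H) * B d = ?f2"
    by (cases a) (simp_all add: D_def H_def left_diff_distrib right_diff_distrib mult.assoc phi_out phi_merge)
  finally have f: "F * (A a * (\<phi> \<omega> * H) * B d) = ?f1 + ?f2" .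
  show ?thesis
    unfolding H_def[symmetric] distrib_right x k f unfolding H_def by (simp add: algebra_simps)
qed

text \<open>By \<open>hbin_Suc\<close> and \<open>hbin_pred_Suc\<close> the two h-binomials of
  length c + 1 are H times g (\<alpha> K^-2 - 1) and g (\<beta> K^-2 - 1), where H is [h;1-m] of
  length c. Both sides are then H times an affine expression in K^-2; the assumptions compare the
  negated constant terms and the coefficients of K^-2.\<close>

lemma hbin_combine:
  fixes m :: int and c :: nat
  defines "g \<equiv> 1 / (qq powi (4 * (1 + int c)) - 1)"
    and "\<alpha> \<equiv> qq powi (4 * (1 + int c) - 4 * m)" and "\<beta> \<equiv> qq powi (- (4 * m))"
  assumes "g * (s1 + s2) + u = g * (s3 + s4) - s5"
    and "g * (s1 * \<alpha> + s2 * \<beta>) + v = g * (s3 * \<alpha> + s4 * \<beta>)"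
  shows "\<phi> s1 * hbin \<phi> Ki (1 - m) (Suc c) + \<phi> s2 * hbin \<phi> Ki (- m) (Suc c)
      + (\<phi> v * Ki ^ 2 - \<phi> u) * hbin \<phi> Ki (1 - m) c
    = \<phi> s3 * hbin \<phi> Ki (1 - m) (Suc c) + \<phi> s4 * hbin \<phi> Ki (- m) (Suc c)
      + \<phi> s5 * hbin \<phi> Ki (1 - m) c"
proof -
  define H where "H = hbin \<phi> Ki (1 - m) c"
  have q: "qq ^ (4 * Suc c) = qq powi (4 * (1 + int c))"
    using power_int_of_nat[of qq "4 * Suc c"] by simp
  have W1: "hbin \<phi> Ki (1 - m) (Suc c) = H * (\<phi> (g * \<alpha>) * Ki ^ 2 - \<phi> g)"
    unfolding hbin_Suc hfac_eq H_def g_def \<alpha>_def q by (simp add: algebra_simps)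
  have W2: "hbin \<phi> Ki (- m) (Suc c) = H * (\<phi> (g * \<beta>) * Ki ^ 2 - \<phi> g)"
    using hbin_pred_Suc[of "1 - m" c] unfolding hfac_eq H_def g_def \<beta>_def q by simp
  have W3: "(\<phi> v * Ki ^ 2 - \<phi> u) * H = H * (\<phi> v * Ki ^ 2 - \<phi> u)"
    unfolding left_diff_distrib right_diff_distrib H_def
    by (metis phi_left_commute phi_central Ki2_hbin mult.assoc)
  have W4: "\<phi> s5 * H = H * \<phi> s5"
    by (rule phi_central)
  have lhs: "\<phi> x * (H * (\<phi> y * Ki ^ 2 - \<phi> g)) = H * (\<phi> (x * y) * Ki ^ 2 - \<phi> (x * g))" for x y
    by (simp add: right_diff_distrib phi_mult mult.assoc phi_left_commute[of H, symmetric])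
  have "\<phi> s1 * hbin \<phi> Ki (1 - m) (Suc c) + \<phi> s2 * hbin \<phi> Ki (- m) (Suc c)
      + (\<phi> v * Ki ^ 2 - \<phi> u) * H
    = H * (\<phi> (g * (s1 * \<alpha> + s2 * \<beta>) + v) * Ki ^ 2 - \<phi> (g * (s1 + s2) + u))"
    unfolding W1 W2 W3 lhs by (simp add: phi_add phi_mult[symmetric] algebra_simps)
  moreover have "\<phi> s3 * hbin \<phi> Ki (1 - m) (Suc c) + \<phi> s4 * hbin \<phi> Ki (- m) (Suc c) + \<phi> s5 * H
    = H * (\<phi> (g * (s3 * \<alpha> + s4 * \<beta>)) * Ki ^ 2 - \<phi> (g * (s3 + s4) - s5))"
    unfolding W1 W2 W4 lhs by (simp add: phi_add phi_diff phi_mult[symmetric] algebra_simps)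
  ultimately show ?thesis
    unfolding assms(4,5) H_def by simp
qed


section \<open>Multiplication by t\<close>

text \<open>All terms with \<open>a + d + 2c > n\<close> vanish, so for \<open>N > n\<close> the cube may be shifted freely.\<close>

definition box :: "qf \<Rightarrow> nat \<Rightarrow> int \<Rightarrow> int \<Rightarrow> (int \<Rightarrow> int \<Rightarrow> int \<Rightarrow> qf) \<Rightarrow> 'a" where
  "box \<kappa> N m n w = (\<Sum>a\<le>N. \<Sum>d\<le>N. \<Sum>c\<le>N.
     A a * (\<phi> (w (int a) (int d) (int c)) *
       (hbin \<phi> Ki (1 - m) c * P \<kappa> (n - int a - int d - 2 * int c))) * B d)"

text \<open>What stands between \<open>A a\<close> and \<open>P \<kappa> J * B d\<close> after
  multiplication by t, with J = n + 1 - a - d - 2c. The \<open>case\<close> gathers the terms that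
  come from c - 1: the lower degree in the recursion of the polynomials, and the commutator of
  \<open>F\<close> with \<open>A (a + 1)\<close>.\<close>

definition tcoeff :: "int \<Rightarrow> (int \<Rightarrow> int \<Rightarrow> int \<Rightarrow> qf) \<Rightarrow> int \<Rightarrow> int \<Rightarrow> int \<Rightarrow> nat \<Rightarrow> 'a" where
  "tcoeff m w a d J c =
     \<phi> (qn a * w (a - 1) d (int c) + qq powi (- 2 * a) * qn J * w a d (int c)) * hbin \<phi> Ki (1 - m) c
     + \<phi> (qq powi (- 2 * a) * qq powi (- 2 * J) * qn d * w a (d - 1) (int c)) * hbin \<phi> Ki (- m) c
     + (case c of 0 \<Rightarrow> 0 | Suc c' \<Rightarrow>
         (\<phi> (qq powi (- 3 * a) / (qq ^ 2 - 1) * w (a + 1) d (int c')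
            - qq powi (- 2 * a) * qq powi (- 2 * J) * qn (J - 1) * w a d (int c')) * Ki ^ 2
          - \<phi> (qq powi (- a) / (qq ^ 2 - 1) * w (a + 1) d (int c'))) * hbin \<phi> Ki (1 - m) c')"

text \<open>The five families of \<open>t_mult_term\<close> are reindexed separately until each
  carries the same \<open>A a\<close>, \<open>P \<kappa> J\<close> and \<open>B d\<close>.\<close>

lemma t_mult_box:
  assumes N: "n < int N"
  shows "(F + X + \<phi> \<kappa> * Ki) * box \<kappa> N m n w = (\<Sum>a\<le>N. \<Sum>d\<le>N. \<Sum>c\<le>N.
     A a * (tcoeff m w (int a) (int d) (n + 1 - int a - int d - 2 * int c) c
       * P \<kappa> (n + 1 - int a - int d - 2 * int c)) * B d)"
proof -
  define J where "J a d c = n + 1 - int a - int d - 2 * int c" for a d c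
  define H where "H c j = hbin \<phi> Ki (1 - m) c * P \<kappa> j" for c j
  define f1 where "f1 a d c = A a * (\<phi> (qn (int a) * w (int a - 1) (int d) (int c)) * H c (J a d c)) * B d" for a d c
  define f2 where "f2 a d c = A a * (\<phi> (qq powi (- 2 * int a) * qn (J a d c) * w (int a) (int d) (int c))
    * H c (J a d c)) * B d" for a d c
  define f3 where "f3 a d c = (case c of 0 \<Rightarrow> 0 | Suc c' \<Rightarrow>
    A a * (\<phi> (qq powi (- 2 * int a) * qq powi (- 2 * J a d c) * qn (J a d c - 1) * w (int a) (int d) (int c'))
      * (Ki ^ 2 * H c' (J a d c))) * B d)" for a d c
  define f4 where "f4 a d c = A a * (\<phi> (qq powi (- 2 * int a) * qq powi (- 2 * J a d c) * qn (int d)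
    * w (int a) (int d - 1) (int c)) * (hbin \<phi> Ki (- m) c * P \<kappa> (J a d c))) * B d" for a d c
  define f5 where "f5 a d c = (case c of 0 \<Rightarrow> 0 | Suc c' \<Rightarrow>
    A a * ((\<phi> (qq powi (- 3 * int a) / (qq ^ 2 - 1) * w (int a + 1) (int d) (int c')) * Ki ^ 2
        - \<phi> (qq powi (- int a) / (qq ^ 2 - 1) * w (int a + 1) (int d) (int c'))) * H c' (J a d c)) * B d)"
    for a d c
  have H0: "H c j = 0" if "j < 0" for c j
    using that by (simp add: H_def)
  have "(F + X + \<phi> \<kappa> * Ki) * (A a * (\<phi> (w (int a) (int d) (int c)) *
       (hbin \<phi> Ki (1 - m) c * P \<kappa> (n - int a - int d - 2 * int c))) * B d)
     = f1 (Suc a) d c + f2 a d c - f3 a d (Suc c) + f4 a (Suc d) c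
       + (case a of 0 \<Rightarrow> 0 | Suc i \<Rightarrow> f5 i d (Suc c))" for a d c
  proof -
    define j where "j = n - int a - int d - 2 * int c"
    have J2: "J (Suc a) d c = j" "J a (Suc d) c = j" "J a d c = j + 1" "J a d (Suc c) = j - 1"
      by (auto simp: J_def j_def)
    have e: "- 2 * (j - 1) = 2 - 2 * j" "j - 1 - 1 = j - 2" by simp_all
    have g1: "f1 (Suc a) d c = A (Suc a) * (\<phi> (qn (int (Suc a)) * w (int a) (int d) (int c)) *
        (hbin \<phi> Ki (1 - m) c * P \<kappa> j)) * B d"
      by (simp add: f1_def J2 H_def)
    have g2: "f2 a d c = A a * (\<phi> (qq powi (- 2 * int a) * qn (j + 1) * w (int a) (int d) (int c)) *
        (hbin \<phi> Ki (1 - m) c * P \<kappa> (j + 1))) * B d"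
      by (simp add: f2_def J2 H_def)
    have g3: "f3 a d (Suc c) = A a * (\<phi> (qq powi (- 2 * int a) * qq powi (2 - 2 * j) * qn (j - 2)
        * w (int a) (int d) (int c)) * (Ki ^ 2 * (hbin \<phi> Ki (1 - m) c * P \<kappa> (j - 1)))) * B d"
      unfolding f3_def J2 H_def e by simp
    have g4: "f4 a (Suc d) c = A a * (\<phi> (qq powi (- 2 * int a) * qq powi (- 2 * j) * qn (int (Suc d))
        * w (int a) (int d) (int c)) * (hbin \<phi> Ki (- m) c * P \<kappa> j)) * B (Suc d)"
      unfolding f4_def J2 by simp
    have g5: "(case a of 0 \<Rightarrow> 0 | Suc i \<Rightarrow> f5 i d (Suc c)) =
      (case a of 0 \<Rightarrow> 0 | Suc i \<Rightarrow> A i * ((\<phi> (qq powi (- 3 * int i) / (qq ^ 2 - 1) * w (int a) (int d) (int c)) * Ki ^ 2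
        - \<phi> (qq powi (- int i) / (qq ^ 2 - 1) * w (int a) (int d) (int c))) * (hbin \<phi> Ki (1 - m) c * P \<kappa> j)) * B d)"
    proof (cases a)
      case (Suc i)
      then have "J i d (Suc c) = j" "int i + 1 = int a" by (auto simp: J_def j_def)
      then show ?thesis unfolding f5_def H_def Suc by (simp add: add.commute)
    qed simp
    show ?thesis
      unfolding g1 g2 g3 g4 g5 unfolding j_def[symmetric] t_mult_term ..
  qed
  then have "(F + X + \<phi> \<kappa> * Ki) * box \<kappa> N m n w =
     (\<Sum>a\<le>N. \<Sum>d\<le>N. \<Sum>c\<le>N. f1 (Suc a) d c) + (\<Sum>a\<le>N. \<Sum>d\<le>N. \<Sum>c\<le>N. f2 a d c)
     - (\<Sum>a\<le>N. \<Sum>d\<le>N. \<Sum>c\<le>N. f3 a d (Suc c)) + (\<Sum>a\<le>N. \<Sum>d\<le>N. \<Sum>c\<le>N. f4 a (Suc d) c)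
     + (\<Sum>a\<le>N. \<Sum>d\<le>N. \<Sum>c\<le>N. (case a of 0 \<Rightarrow> 0 | Suc i \<Rightarrow> f5 i d (Suc c)))"
    by (simp add: box_def sum_distrib_left sum.distrib sum_subtractf)
  also have "(\<Sum>a\<le>N. \<Sum>d\<le>N. \<Sum>c\<le>N. f1 (Suc a) d c) = (\<Sum>a\<le>N. \<Sum>d\<le>N. \<Sum>c\<le>N. f1 a d c)"
    \<comment> \<open>At a = 0 the factor [0] vanishes, and at a = N + 1 the degree J is negative.
      The later shifts lose nothing at the boundary for the same reasons, or by the zero branch of a
      \<open>case\<close>.\<close>
    by (rule sum_atMost_shift_up) (use N in \<open>simp_all add: f1_def H0 J_def\<close>)
  also have "(\<Sum>a\<le>N. \<Sum>d\<le>N. \<Sum>c\<le>N. f3 a d (Suc c)) = (\<Sum>a\<le>N. \<Sum>d\<le>N. \<Sum>c\<le>N. f3 a d c)"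
    by (intro sum.cong refl sum_atMost_shift_up) (use N in \<open>simp_all add: f3_def H0 J_def\<close>)
  also have "(\<Sum>a\<le>N. \<Sum>d\<le>N. \<Sum>c\<le>N. f4 a (Suc d) c) = (\<Sum>a\<le>N. \<Sum>d\<le>N. \<Sum>c\<le>N. f4 a d c)"
    by (intro sum.cong refl sum_atMost_shift_up) (use N in \<open>simp_all add: f4_def J_def\<close>)
  also have "(\<Sum>a\<le>N. \<Sum>d\<le>N. \<Sum>c\<le>N. (case a of 0 \<Rightarrow> 0 | Suc i \<Rightarrow> f5 i d (Suc c)))
     = (\<Sum>a\<le>N. case a of 0 \<Rightarrow> 0 | Suc i \<Rightarrow> \<Sum>d\<le>N. \<Sum>c\<le>N. f5 i d (Suc c))"
    by (intro sum.cong refl) (auto split: nat.split)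
  also have "\<dots> = (\<Sum>a\<le>N. \<Sum>d\<le>N. \<Sum>c\<le>N. f5 a d (Suc c))"
    by (rule sum_atMost_shift_down) (use N in \<open>simp add: f5_def H0 J_def\<close>)
  also have "\<dots> = (\<Sum>a\<le>N. \<Sum>d\<le>N. \<Sum>c\<le>N. f5 a d c)"
    by (intro sum.cong refl sum_atMost_shift_up) (use N in \<open>simp_all add: f5_def H0 J_def\<close>)
  also have "(\<Sum>a\<le>N. \<Sum>d\<le>N. \<Sum>c\<le>N. f1 a d c) + (\<Sum>a\<le>N. \<Sum>d\<le>N. \<Sum>c\<le>N. f2 a d c)
     - (\<Sum>a\<le>N. \<Sum>d\<le>N. \<Sum>c\<le>N. f3 a d c) + (\<Sum>a\<le>N. \<Sum>d\<le>N. \<Sum>c\<le>N. f4 a d c)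
     + (\<Sum>a\<le>N. \<Sum>d\<le>N. \<Sum>c\<le>N. f5 a d c)
     = (\<Sum>a\<le>N. \<Sum>d\<le>N. \<Sum>c\<le>N. f1 a d c + f2 a d c - f3 a d c + f4 a d c + f5 a d c)"
    by (simp add: sum.distrib sum_subtractf)
  also have "\<dots> = (\<Sum>a\<le>N. \<Sum>d\<le>N. \<Sum>c\<le>N.
     A a * (tcoeff m w (int a) (int d) (J a d c) c * P \<kappa> (J a d c)) * B d)"
    by (intro sum.cong refl)
      (simp add: f1_def f2_def f3_def f4_def f5_def H_def tcoeff_def distrib_left distrib_right
        left_diff_distrib right_diff_distrib phi_add phi_diff mult.assoc split: nat.split)
  finally show ?thesis unfolding J_def .
qed


text \<open>Every weight is written as the target weight \<open>w0\<close> times a power of q. At c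
  = 0 the h-binomials are 1 and \<open>qn_telescope\<close> suffices; otherwise
  \<open>hbin_combine\<close> reduces the claim to \<open>coeff_even_const\<close> and
  \<open>coeff_even_square\<close>.\<close>

lemma tcoeff_even:
  assumes J: "J = 2 * m + 1 - a - d - 2 * int c"
  shows "tcoeff m (wt 1 (2 * m)) a d J c
    = \<phi> (qn (2 * m + 1) * wt (-1) (2 * m + 1) a d (int c)) * hbin \<phi> Ki (1 - m) c"
proof -
  define w0 where "w0 = wt (-1) (2 * m + 1) a d (int c)"
  have m: "2 * m + 1 = J + a + d + 2 * int c" using J by simp
  have w1: "wt 1 (2 * m) (a - 1) d (int c) = w0 * qq powi (2 * int c + J + d)"
    unfolding w0_def J by (rule wt_shift) (simp add: algebra_simps power2_eq_square)
  have w2: "wt 1 (2 * m) a d (int c) = w0 * qq powi (2 * int c + a + d)"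
    unfolding w0_def J by (rule wt_shift) (simp add: algebra_simps power2_eq_square)
  have w3: "wt 1 (2 * m) a (d - 1) (int c) = w0 * qq powi (2 * int c + J + a)"
    unfolding w0_def J by (rule wt_shift) (simp add: algebra_simps power2_eq_square)
  define s1 where "s1 = w0 * (qn a * qq powi (2 * int c + J + d) + qn J * qq powi (2 * int c - a + d))"
  define s2 where "s2 = w0 * (qn d * qq powi (2 * int c - J - a))"
  have s1: "qn a * wt 1 (2 * m) (a - 1) d (int c) + qq powi (- 2 * a) * qn J * wt 1 (2 * m) a d (int c) = s1"
    unfolding w1 w2 s1_def by (simp add: powi_expand) (simp add: field_simps power2_eq_square)
  have s2: "qq powi (- 2 * a) * qq powi (- 2 * J) * qn d * wt 1 (2 * m) a (d - 1) (int c) = s2"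
    unfolding w3 s2_def by (simp add: powi_expand) (simp add: field_simps power2_eq_square)
  show ?thesis
  proof (cases c)
    case 0
    have "s1 + s2 = w0 * qn (2 * m + 1)"
      unfolding s1_def s2_def m using qn_telescope[of a J d] 0 
      by (simp add: algebra_simps flip: distrib_left)
    then show ?thesis
      unfolding tcoeff_def s1 s2 w0_def[symmetric] using 0
      by (simp add: mult.commute flip: phi_add)
  next
    case (Suc c')
    have c: "1 + int c' = int c" using Suc by simp
    have nz: "qq powi (4 * int c) \<noteq> 1"
      using qq_power_eq_1_iff[of "4 * c"] power_int_of_nat[of qq "4 * c"] Suc by simp
    have w4: "wt 1 (2 * m) a d (int c') = w0 * qq powi (1 - 2 * int c - a - d)"
      unfolding w0_def J Suc by (rule wt_shift) (simp add: algebra_simps power2_eq_square)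
    have w5: "wt 1 (2 * m) (a + 1) d (int c') = w0 * qq powi (1 - 2 * int c - J - d)"
      unfolding w0_def J Suc by (rule wt_shift) (simp add: algebra_simps power2_eq_square)
    have v: "qq powi (- 3 * a) / (qq ^ 2 - 1) * wt 1 (2 * m) (a + 1) d (int c')
            - qq powi (- 2 * a) * qq powi (- 2 * J) * qn (J - 1) * wt 1 (2 * m) a d (int c')
      = w0 * (qq powi (1 - 2 * int c - J - d - 3 * a) / (qq ^ 2 - 1)
          - qn (J - 1) * qq powi (1 - 2 * int c - 3 * a - d - 2 * J))"
      unfolding w4 w5 by (simp add: powi_expand) (simp add: field_simps eval_nat_numeral)
    have u: "qq powi (- a) / (qq ^ 2 - 1) * wt 1 (2 * m) (a + 1) d (int c')
      = w0 * (qq powi (1 - 2 * int c - J - d - a) / (qq ^ 2 - 1))"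
      unfolding w5 by (simp add: powi_expand) (simp add: field_simps)
    have m4: "4 * m = 2 * (J + a + d + 2 * int c - 1)" using J by simp
    \<comment> \<open>The zero scalars fill the slots \<open>s4\<close> and \<open>s5\<close> of
      \<open>hbin_combine\<close>, which is applied at length c' = c - 1.\<close>
    have "\<phi> s1 * hbin \<phi> Ki (1 - m) c + \<phi> s2 * hbin \<phi> Ki (- m) c
        + (\<phi> (w0 * (qq powi (1 - 2 * int c - J - d - 3 * a) / (qq ^ 2 - 1)
          - qn (J - 1) * qq powi (1 - 2 * int c - 3 * a - d - 2 * J))) * Ki ^ 2
          - \<phi> (w0 * (qq powi (1 - 2 * int c - J - d - a) / (qq ^ 2 - 1)))) * hbin \<phi> Ki (1 - m) c'
      = \<phi> (w0 * qn (2 * m + 1)) * hbin \<phi> Ki (1 - m) c + \<phi> 0 * hbin \<phi> Ki (- m) c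
        + \<phi> 0 * hbin \<phi> Ki (1 - m) c'"
      unfolding Suc
    proof (rule hbin_combine, unfold c m4 m s1_def s2_def Suc[symmetric], goal_cases)
      case 1
      show ?case using arg_cong[OF coeff_even_const[OF nz, of a J d], of "(*) w0"]
        by (simp add: distrib_left add_divide_distrib algebra_simps)
    next
      case 2
      show ?case using arg_cong[OF coeff_even_square[OF nz, of a J d], of "(*) w0"]
        by (simp add: distrib_left add_divide_distrib right_diff_distrib algebra_simps)
    qed
    then show ?thesis
      unfolding tcoeff_def s1 s2 w0_def[symmetric] by (simp only: Suc nat.case v u)
        (simp add: mult.commute)
  qed
qed


text \<open>The target is [h;1-(m+1)] = [h;-m], and the \<open>case\<close> is the contribution of
  t^(2m). The latter sits at c - 1 because J = 2m - a - d - 2(c - 1).\<close>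

lemma tcoeff_odd:
  assumes J: "J = 2 * m + 2 - a - d - 2 * int c"
  shows "tcoeff m (wt (-1) (2 * m + 1)) a d J c
    = \<phi> (qn (2 * m + 2) * wt 1 (2 * m + 2) a d (int c)) * hbin \<phi> Ki (- m) c
      + (case c of 0 \<Rightarrow> 0 | Suc c' \<Rightarrow>
          \<phi> (qn (2 * m + 1) * wt 1 (2 * m) a d (int c')) * hbin \<phi> Ki (1 - m) c')"
proof -
  define w0 where "w0 = wt 1 (2 * m + 2) a d (int c)"
  let ?w = "wt (-1) (2 * m + 1)"
  have m: "2 * m + 2 = J + a + d + 2 * int c" using J by simp
  have w1: "?w (a - 1) d (int c) = w0 * qq powi (J + d - 2 * int c)"
    unfolding w0_def J by (rule wt_shift) (simp add: algebra_simps power2_eq_square)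
  have w2: "?w a d (int c) = w0 * qq powi (a + d - 2 * int c)"
    unfolding w0_def J by (rule wt_shift) (simp add: algebra_simps power2_eq_square)
  have w3: "?w a (d - 1) (int c) = w0 * qq powi (J + a - 2 * int c)"
    unfolding w0_def J by (rule wt_shift) (simp add: algebra_simps power2_eq_square)
  define s1 where "s1 = w0 * (qn a * qq powi (J + d - 2 * int c) + qn J * qq powi (d - a - 2 * int c))"
  define s2 where "s2 = w0 * (qn d * qq powi (- 2 * int c - J - a))"
  have s1: "qn a * ?w (a - 1) d (int c) + qq powi (- 2 * a) * qn J * ?w a d (int c) = s1"
    unfolding w1 w2 s1_def by (simp add: powi_expand) (simp add: field_simps power2_eq_square)
  have s2: "qq powi (- 2 * a) * qq powi (- 2 * J) * qn d * ?w a (d - 1) (int c) = s2"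
    unfolding w3 s2_def by (simp add: powi_expand) (simp add: field_simps power2_eq_square)
  show ?thesis
  proof (cases c)
    case 0
    have "s1 + s2 = w0 * qn (2 * m + 2)"
      unfolding s1_def s2_def m using qn_telescope[of a J d] 0
      by (simp add: algebra_simps flip: distrib_left)
    then show ?thesis
      unfolding tcoeff_def s1 s2 w0_def[symmetric] using 0
      by (simp add: mult.commute flip: phi_add)
  next
    case (Suc c')
    have c: "1 + int c' = int c" using Suc by simp
    have nz: "qq powi (4 * int c) \<noteq> 1"
      using qq_power_eq_1_iff[of "4 * c"] power_int_of_nat[of qq "4 * c"] Suc by simp
    have w4: "?w a d (int c') = w0 * qq powi (3 - 6 * int c - a - d)"
      unfolding w0_def J Suc by (rule wt_shift) (simp add: algebra_simps power2_eq_square)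
    have w5: "?w (a + 1) d (int c') = w0 * qq powi (3 - 6 * int c - J - d)"
      unfolding w0_def J Suc by (rule wt_shift) (simp add: algebra_simps power2_eq_square)
    have w6: "wt 1 (2 * m) a d (int c') = w0 * qq powi (1 - 4 * int c)"
      unfolding w0_def Suc by (rule wt_shift) (simp add: algebra_simps power2_eq_square)
    have v: "qq powi (- 3 * a) / (qq ^ 2 - 1) * ?w (a + 1) d (int c')
            - qq powi (- 2 * a) * qq powi (- 2 * J) * qn (J - 1) * ?w a d (int c')
      = w0 * (qq powi (3 - 6 * int c - J - d - 3 * a) / (qq ^ 2 - 1)
          - qn (J - 1) * qq powi (3 - 6 * int c - 3 * a - d - 2 * J))"
      unfolding w4 w5 by (simp add: powi_expand) (simp add: field_simps eval_nat_numeral)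
    have u: "qq powi (- a) / (qq ^ 2 - 1) * ?w (a + 1) d (int c')
      = w0 * (qq powi (3 - 6 * int c - J - d - a) / (qq ^ 2 - 1))"
      unfolding w5 by (simp add: powi_expand) (simp add: field_simps)
    have m4: "4 * m = 2 * (J + a + d + 2 * int c - 2)" using J by simp
    have m1: "2 * m + 1 = J + a + d + 2 * int c - 1" using J by simp
    have "\<phi> s1 * hbin \<phi> Ki (1 - m) c + \<phi> s2 * hbin \<phi> Ki (- m) c
        + (\<phi> (w0 * (qq powi (3 - 6 * int c - J - d - 3 * a) / (qq ^ 2 - 1)
          - qn (J - 1) * qq powi (3 - 6 * int c - 3 * a - d - 2 * J))) * Ki ^ 2
          - \<phi> (w0 * (qq powi (3 - 6 * int c - J - d - a) / (qq ^ 2 - 1)))) * hbin \<phi> Ki (1 - m) c'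
      = \<phi> 0 * hbin \<phi> Ki (1 - m) c + \<phi> (w0 * qn (2 * m + 2)) * hbin \<phi> Ki (- m) c
        + \<phi> (qn (2 * m + 1) * (w0 * qq powi (1 - 4 * int c))) * hbin \<phi> Ki (1 - m) c'"
      unfolding Suc
    proof (rule hbin_combine, unfold c m4 m m1 s1_def s2_def Suc[symmetric], goal_cases)
      case 1
      show ?case using arg_cong[OF coeff_odd_const[OF nz, of a J d], of "(*) w0"]
        by (simp add: distrib_left add_divide_distrib right_diff_distrib algebra_simps)
    next
      case 2
      show ?case using arg_cong[OF coeff_odd_square[OF nz, of a J d], of "(*) w0"]
        by (simp add: distrib_left add_divide_distrib right_diff_distrib algebra_simps)
    qed
    then show ?thesis
      unfolding tcoeff_def s1 s2 w0_def[symmetric] by (simp only: Suc nat.case v u w6)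
        (simp add: mult.commute)
  qed
qed

lemma t_mult_box_even:
  assumes "2 * m < int N"
  shows "(F + X + \<phi> \<kappa> * Ki) * box \<kappa> N m (2 * m) (wt 1 (2 * m))
    = \<phi> (qn (2 * m + 1)) * box \<kappa> N m (2 * m + 1) (wt (-1) (2 * m + 1))"
  unfolding t_mult_box[OF assms] tcoeff_even[OF refl] unfolding box_def sum_distrib_left
  by (intro sum.cong refl) (simp add: phi_mult mult.assoc phi_left_commute[of "dpow _ _ _"])

lemma t_mult_box_odd:
  assumes "2 * m + 1 < int N"
  shows "(F + X + \<phi> \<kappa> * Ki) * box \<kappa> N m (2 * m + 1) (wt (-1) (2 * m + 1))
    = \<phi> (qn (2 * m + 2)) * box \<kappa> N (m + 1) (2 * m + 2) (wt 1 (2 * m + 2))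
      + \<phi> (qn (2 * m + 1)) * box \<kappa> N m (2 * m) (wt 1 (2 * m))"
proof -
  have e: "2 * m + 1 + 1 = 2 * m + 2" "1 - (m + 1) = - m" by simp_all
  define g where "g a d c = A a * (\<phi> (wt 1 (2 * m) (int a) (int d) (int c)) *
       (hbin \<phi> Ki (1 - m) c * P \<kappa> (2 * m - int a - int d - 2 * int c))) * B d" for a d c
  have *: "A a * ((\<phi> (qn (2 * m + 2) * wt 1 (2 * m + 2) (int a) (int d) (int c)) * hbin \<phi> Ki (- m) c
      + (case c of 0 \<Rightarrow> 0 | Suc c' \<Rightarrow>
          \<phi> (qn (2 * m + 1) * wt 1 (2 * m) (int a) (int d) (int c')) * hbin \<phi> Ki (1 - m) c'))
      * P \<kappa> (2 * m + 2 - int a - int d - 2 * int c)) * B d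
    = \<phi> (qn (2 * m + 2)) * (A a * (\<phi> (wt 1 (2 * m + 2) (int a) (int d) (int c)) * (hbin \<phi> Ki (- m) c
        * P \<kappa> (2 * m + 2 - int a - int d - 2 * int c))) * B d)
      + \<phi> (qn (2 * m + 1)) * (case c of 0 \<Rightarrow> 0 | Suc c' \<Rightarrow> g a d c')" for a d c
  proof (cases c)
    case 0
    then show ?thesis by (simp add: phi_mult mult.assoc phi_left_commute[of "dpow _ _ _"])
  next
    case (Suc c')
    have "2 * m + 2 - int a - int d - 2 * int c = 2 * m - int a - int d - 2 * int c'"
      using Suc by simp
    then show ?thesis
      by (simp only: Suc g_def nat.case)
        (simp add: phi_mult mult.assoc phi_left_commute[of "dpow _ _ _"] distrib_left distrib_right)
  qed
  have "(\<Sum>c\<le>N. case c of 0 \<Rightarrow> 0 | Suc c' \<Rightarrow> g a d c') = (\<Sum>c\<le>N. g a d c)" for a d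
    by (rule sum_atMost_shift_down) (use assms in \<open>simp add: g_def\<close>)
  then have "(\<Sum>a\<le>N. \<Sum>d\<le>N. \<Sum>c\<le>N. case c of 0 \<Rightarrow> 0 | Suc c' \<Rightarrow> g a d c')
      = box \<kappa> N m (2 * m) (wt 1 (2 * m))"
    by (simp add: box_def g_def)
  then show ?thesis
    unfolding t_mult_box[OF assms] e tcoeff_odd[OF refl] * box_def[of _ _ "m + 1"]
    by (simp add: sum.distrib flip: sum_distrib_left)
qed

text \<open>With \<open>n = 0\<close> only a = d = c = 0 gives a nonnegative degree.\<close>

lemma box_0: "box \<kappa> N 0 0 (wt 1 0) = 1"
  unfolding box_def sum.atMost_shift
  by (simp add: P_def pdiv_def wt_def dpow_def)

section \<open>The recursion for the divided powers of t\<close>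

definition tprod :: "'a \<Rightarrow> nat \<Rightarrow> 'a" where
  "tprod t m = prod_list (map (\<lambda>j. t - \<phi> (qn (2 * j - 1))) [- int m + 1..int m])"

text \<open>The range of j gains -m and m + 1, and [-2m-1] = -[2m+1]. The new factors are thus t +
  [2m+1] and t - [2m+1].\<close>

lemma tprod_Suc:
  "tprod t (Suc m) = (t + \<phi> (qn (2 * int m + 1))) * tprod t m * (t - \<phi> (qn (2 * int m + 1)))"
proof -
  have "[- int (Suc m) + 1..int (Suc m)] = (- int m) # [- int m + 1..int m] @ [int m + 1]"
    using upto_rec1[of "- int m" "int m + 1"] upto_rec2[of "- int m + 1" "int m + 1"]
    by (simp add: add.commute)
  moreover have "qn (2 * (- int m) - 1) = - qn (2 * int m + 1)"
    by (simp flip: qn_minus)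
  moreover have "2 * (int m + 1) - 1 = 2 * int m + 1" by simp
  ultimately show ?thesis
    by (simp add: tprod_def phi_uminus mult.assoc add.commute[of 1])
qed

lemma t_mult_tprod: "t * tprod t m = tprod t m * t"
proof (induction m)
  case 0
  show ?case by (simp add: tprod_def)
next
  case (Suc m)
  let ?q = "\<phi> (qn (2 * int m + 1))"
  have 1: "t * (t + ?q) = (t + ?q) * t" "t * (t - ?q) = (t - ?q) * t"
    by (simp_all add: algebra_simps phi_central[of _ t, symmetric])
  have "t * tprod t (Suc m) = (t * (t + ?q)) * tprod t m * (t - ?q)"
    by (simp add: tprod_Suc mult.assoc)
  also have "\<dots> = (t + ?q) * (t * tprod t m) * (t - ?q)"
    unfolding 1 by (simp add: mult.assoc)
  also have "\<dots> = (t + ?q) * tprod t m * (t * (t - ?q))"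
    unfolding Suc by (simp add: mult.assoc)
  also have "\<dots> = tprod t (Suc m) * t"
    unfolding 1 by (simp add: tprod_Suc mult.assoc)
  finally show ?case .
qed

lemma tdot_eq: "tdot \<phi> t (2 * m) = \<phi> (inverse (qfact (2 * m))) * tprod t m"
  "tdot \<phi> t (2 * m + 1) = \<phi> (inverse (qfact (2 * m + 1))) * (t * tprod t m)"
  by (simp_all add: tdot_def tprod_def mult.assoc)

lemma t_mult_tdot_even:
  "t * tdot \<phi> t (2 * m) = \<phi> (qn (2 * int m + 1)) * tdot \<phi> t (2 * m + 1)"
proof -
  have "qn (2 * int m + 1) * inverse (qfact (2 * m + 1)) = inverse (qfact (2 * m))"
    using qn_nonzero[of "2 * m + 1"] qfact_Suc[of "2 * m"] by (simp add: add.commute)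
  then show ?thesis
    unfolding tdot_eq by (simp add: phi_left_commute[of t] phi_merge)
qed

text \<open>By \<open>tprod_Suc\<close> the product grows by the factor t^2 - [2m+1]^2; solving for
  t^2 and using [2m+1]^2 / [2m+1]! = [2m+1] / [2m]! gives the second term.\<close>

lemma t_mult_tdot_odd:
  "t * tdot \<phi> t (2 * m + 1) = \<phi> (qn (2 * int m + 2)) * tdot \<phi> t (2 * Suc m)
    + \<phi> (qn (2 * int m + 1)) * tdot \<phi> t (2 * m)"
proof -
  let ?q = "qn (2 * int m + 1)" and ?i = "inverse (qfact (2 * m + 1))"
  have 1: "qn (2 * int m + 2) * inverse (qfact (2 * Suc m)) = ?i"
    using qn_nonzero[of "2 * m + 2"] qfact_Suc[of "2 * m + 1"] by (simp add: add.commute)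
  have 2: "?q * inverse (qfact (2 * m)) = ?i * (?q * ?q)"
    using qn_nonzero[of "2 * m + 1"] qfact_Suc[of "2 * m"] by (simp add: add.commute)
  have "tprod t (Suc m) = t * (t * tprod t m) - \<phi> (?q * ?q) * tprod t m"
    unfolding tprod_Suc
    by (simp add: algebra_simps phi_mult phi_left_commute[of t] phi_central[of _ t, symmetric] phi_central[of _ "tprod t m", symmetric]
      flip: t_mult_tprod)
  then have "t * (t * tprod t m) = tprod t (Suc m) + \<phi> (?q * ?q) * tprod t m" by simp
  then show ?thesis
    unfolding tdot_eq phi_left_commute[of t] phi_merge 1 2
    by (simp add: distrib_left phi_merge)
qed

section \<open>Induction on m and return to the stated sums\<close>

lemma phi_cancel: "x \<noteq> 0 \<Longrightarrow> \<phi> x * y = \<phi> x * z \<Longrightarrow> y = z"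
  by (metis left_inverse mult_1 phi_1 phi_merge)

text \<open>Both sides satisfy the same recursion, and nonzero quantum integers can be cancelled.
  The even case gives the odd one for the same m, and the two together give the next even case, all
  with one fixed \<open>N\<close>.\<close>

lemma tdot_eq_box:
  fixes \<kappa> :: qf
  assumes "2 * m + 1 < N"
  defines "t \<equiv> F + X + \<phi> \<kappa> * Ki"
  shows "tdot \<phi> t (2 * m) = box \<kappa> N (int m) (2 * int m) (wt 1 (2 * int m)) \<and>
    tdot \<phi> t (2 * m + 1) = box \<kappa> N (int m) (2 * int m + 1) (wt (-1) (2 * int m + 1))"
proof -
  have odd: "tdot \<phi> t (2 * m + 1) = box \<kappa> N (int m) (2 * int m + 1) (wt (-1) (2 * int m + 1))"
    if "2 * m + 1 < N" "tdot \<phi> t (2 * m) = box \<kappa> N (int m) (2 * int m) (wt 1 (2 * int m))" for m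
  proof (rule phi_cancel)
    show "qn (2 * int m + 1) \<noteq> 0"
      using qn_nonzero[of "2 * m + 1"] by (simp add: add.commute)
    show "\<phi> (qn (2 * int m + 1)) * tdot \<phi> t (2 * m + 1) =
        \<phi> (qn (2 * int m + 1)) * box \<kappa> N (int m) (2 * int m + 1) (wt (-1) (2 * int m + 1))"
      using t_mult_box_even[of "int m" N \<kappa>] t_mult_tdot_even[of t m] that
      unfolding t_def[symmetric] by simp
  qed
  have even: "tdot \<phi> t (2 * m) = box \<kappa> N (int m) (2 * int m) (wt 1 (2 * int m))" if "2 * m + 1 < N" for m
    using that
  proof (induction m)
    case 0
    show ?case using box_0[of \<kappa> N] by (simp add: tdot_def)
  next
    case (Suc m)
    then have IH: "tdot \<phi> t (2 * m) = box \<kappa> N (int m) (2 * int m) (wt 1 (2 * int m))" by simp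
    have N: "2 * int m + 1 < int N" using Suc.prems by simp
    have e: "int (Suc m) = int m + 1" "2 * int (Suc m) = 2 * int m + 2" by simp_all
    have "\<phi> (qn (2 * int m + 2)) * tdot \<phi> t (2 * Suc m)
        = \<phi> (qn (2 * int m + 2)) * box \<kappa> N (int m + 1) (2 * int m + 2) (wt 1 (2 * int m + 2))"
      using t_mult_box_odd[OF N, of \<kappa>] t_mult_tdot_odd[of t m] odd[OF _ IH] Suc.prems IH
      unfolding t_def[symmetric] by simp
    then show ?case
      unfolding e(2) unfolding e(1) by (rule phi_cancel[rotated]) (use qn_nonzero[of "2 * m + 2"] in \<open>simp add: add.commute\<close>)
  qed
  show ?thesis using odd even assms(1) by blast
qed

lemma box_eq:
  assumes "n \<le> N" "m \<le> N" "n \<le> 2 * m + 1"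
  shows "box \<kappa> N (int m) (int n) w = (\<Sum>b = 0..n. \<Sum>a = 0..b. \<Sum>c = 0..m.
    \<phi> (w (int a) (int b - int a) (int c) * pdiv \<kappa> (int n - int b - 2 * int c))
      * A a * hbin \<phi> Ki (1 - int m) c * kpow K Ki (int b - int n + 2 * int c) * B (b - a))"
  unfolding box_def
proof (subst sum_box_eq_triangle[OF _ assms], goal_cases)
  case (1 a d c)
  then show ?case by simp
next
  case 2
  show ?case
  proof (intro sum.cong refl)
    fix b a c assume "b \<in> {0..n}" "a \<in> {0..b}" "c \<in> {0..m}"
    then have a: "a \<le> b" by simp
    define j where "j = int n - int b - 2 * int c"
    have j: "int n - int a - (int b - int a) - 2 * int c = j" "int b - int n + 2 * int c = - j"
      "int (b - a) = int b - int a"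
      using a by (simp_all add: j_def)
    show "A a * (\<phi> (w (int a) (int (b - a)) (int c)) * (hbin \<phi> Ki (1 - int m) c
        * P \<kappa> (int n - int a - int (b - a) - 2 * int c))) * B (b - a)
      = \<phi> (w (int a) (int b - int a) (int c) * pdiv \<kappa> (int n - int b - 2 * int c))
      * A a * hbin \<phi> Ki (1 - int m) c * kpow K Ki (int b - int n + 2 * int c) * B (b - a)"
      unfolding j j_def[symmetric]
    \<comment> \<open>For \<open>j < 0\<close> the right-hand side contains a positive power of K,
      but its coefficient \<open>pdiv \<kappa> j\<close> is 0; otherwise only K^-1 occurs.\<close>
    proof (cases "j < 0")
      case False
      then have "kpow K Ki (- j) = Ki ^ nat j" by (auto simp: kpow_def)
      then show "A a * (\<phi> (w (int a) (int b - int a) (int c)) * (hbin \<phi> Ki (1 - int m) c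
        * P \<kappa> j)) * B (b - a)
      = \<phi> (w (int a) (int b - int a) (int c) * pdiv \<kappa> j)
      * A a * hbin \<phi> Ki (1 - int m) c * kpow K Ki (- j) * B (b - a)"
        by (simp add: P_def mult.assoc phi_left_commute[of "dpow _ _ _"]
            phi_left_commute[of "hbin _ _ _ _"] phi_merge)
    qed simp
  qed
qed

end

text \<open>Matches the exponents of the theorem with \<open>wt\<close>: adding 2c gives 2c^2 + c
  for even index, and 2c^2 - c itself occurs for odd index.\<close>

lemma int_choose_two_double: "int ((2 * c) choose 2) = 2 * (int c)\<^sup>2 - int c"
proof -
  have "2 * c * (2 * c - 1) div 2 = c * (2 * c - 1)"
    by (metis mult.assoc nonzero_mult_div_cancel_left zero_neq_numeral)
  then show ?thesis
    by (cases c) (simp_all add: choose_two algebra_simps power2_eq_square)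
qed

theorem theorem4p5:
  fixes \<phi> :: "qf \<Rightarrow> 'a::ring_1" and E F K Ki :: 'a and l :: int and m :: nat
  assumes "Uq_alg \<phi> E F K Ki"
  defines "\<kappa> \<equiv> qn (2 * l - 1)"
  defines "t \<equiv> F + Echeck \<phi> E Ki + \<phi> \<kappa> * Ki"
  shows "tdot \<phi> t (2 * m) =
           (\<Sum>b = 0..2 * m. \<Sum>a = 0..b. \<Sum>c = 0..m.
              \<phi> (qq powi (int ((2 * c) choose 2) + 2 * int c
                          - int b * (2 * int m - int b - 2 * int c) - int a * (int b - int a))
                  * pdiv \<kappa> (2 * int m - int b - 2 * int c))
              * dpow \<phi> (Echeck \<phi> E Ki) a * hbin \<phi> Ki (1 - int m) c
              * kpow K Ki (int b - 2 * int m + 2 * int c) * dpow \<phi> F (b - a))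
       \<and> tdot \<phi> t (2 * m + 1) =
           (\<Sum>b = 0..2 * m + 1. \<Sum>a = 0..b. \<Sum>c = 0..m.
              \<phi> (qq powi (int ((2 * c) choose 2)
                          - int b * (2 * int m - int b - 2 * int c + 1) - int a * (int b - int a))
                  * pdiv \<kappa> (2 * int m - int b - 2 * int c + 1))
              * dpow \<phi> (Echeck \<phi> E Ki) a * hbin \<phi> Ki (1 - int m) c
              * kpow K Ki (int b - 2 * int m + 2 * int c - 1) * dpow \<phi> F (b - a))"
proof -
  interpret Uq \<phi> E F K Ki by unfold_locales fact
  have t: "t = F + X + \<phi> \<kappa> * Ki" by (simp add: t_def)
  have e: "qq powi (int ((2 * c) choose 2) + 2 * int c
        - int b * (2 * int m - int b - 2 * int c) - int a * (int b - int a))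
      = wt 1 (2 * int m) (int a) (int b - int a) (int c)"
    "qq powi (int ((2 * c) choose 2)
        - int b * (2 * int m - int b - 2 * int c + 1) - int a * (int b - int a))
      = wt (-1) (2 * int m + 1) (int a) (int b - int a) (int c)" for a b c
    unfolding wt_def int_choose_two_double
    by (intro arg_cong[where f = "power_int qq"]; simp add: algebra_simps)+
  have x: "2 * int m - int b - 2 * int c + 1 = 2 * int m + 1 - int b - 2 * int c"
    "int b - 2 * int m + 2 * int c - 1 = int b - (2 * int m + 1) + 2 * int c" for b c by simp_all
  have n: "int (2 * m) = 2 * int m" "int (2 * m + 1) = 2 * int m + 1" by simp_all
  show ?thesis
    using tdot_eq_box[of m "2 * m + 2" \<kappa>] box_eq[of "2 * m" "2 * m + 2" m \<kappa> "wt 1 (2 * int m)"]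
      box_eq[of "2 * m + 1" "2 * m + 2" m \<kappa> "wt (-1) (2 * int m + 1)"]
    unfolding e t n unfolding x by simp
qed

end
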